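(* For every integer $n \geq 6$, the number of Ulam words of length $n$ satisfies $\#\mathscr{U}_n \geq 2n+4$.
   Context: Words are finite nonempty strings over the alphabet $\{0,1\}$, with concatenation written $u_1 {}^\frown u_2$. The set $\mathscr{U}$ of Ulam words is defined recursively on length: the one-letter words $0$ and $1$ are Ulam; a word $w \neq 0,1$ is Ulam if and only if there exists exactly one (ordered) pair $(u_1,u_2)$ of Ulam words with $u_1 \neq u_2$ and $w = u_1 {}^\frown u_2$. $\mathscr{U}_n$ denotes the set of Ulam words of length $n$. *)

theory Defs
  imports Main
begin

text \<open>Words over \<open>{0, 1}\<close> are nonempty boolean lists, with \<open>False\<close> for the letter 0 and
  \<open>True\<close> for the letter 1.  The empty list is not a word; it does not satisfy \<open>ulam\<close>.\<close>

text \<open>The guards \<open>u1 \<noteq> []\<close> and \<open>u2 \<noteq> []\<close> make the recursion on the length well-founded; they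
  are redundant, as the lemma \<open>ulam_iff\<close> shows.\<close>

context
  notes conj_cong [fundef_cong]
begin

function ulam :: "bool list \<Rightarrow> bool" where
  "ulam w \<longleftrightarrow> w = [False] \<or> w = [True] \<or>
     (\<exists>!p. fst p \<noteq> [] \<and> snd p \<noteq> [] \<and> w = fst p @ snd p \<and> fst p \<noteq> snd p \<and>
           ulam (fst p) \<and> ulam (snd p))"
  by pat_completeness auto

termination
  by (relation "measure length") auto

end

declare ulam.simps [simp del]

lemma not_ulam_Nil: "\<not> ulam []"
  by (subst ulam.simps) auto

lemma ulam_letter: "ulam [b]"
  by (subst ulam.simps) simp

lemma ulam_iff:
  assumes "w \<noteq> [False]" and "w \<noteq> [True]"
  shows "ulam w \<longleftrightarrow>
    (\<exists>!(u1, u2). ulam u1 \<and> ulam u2 \<and> u1 \<noteq> u2 \<and> w = u1 @ u2)"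
proof -
  have "fst p \<noteq> [] \<and> snd p \<noteq> [] \<and> w = fst p @ snd p \<and> fst p \<noteq> snd p \<and>
          ulam (fst p) \<and> ulam (snd p)
      \<longleftrightarrow> (case p of (u1, u2) \<Rightarrow> ulam u1 \<and> ulam u2 \<and> u1 \<noteq> u2 \<and> w = u1 @ u2)" for p
    using not_ulam_Nil by (cases p) auto
  then show ?thesis
    using assms by (subst ulam.simps) simp
qed

definition ulam_words :: "nat \<Rightarrow> bool list set" where
  "ulam_words n = {w. ulam w \<and> length w = n}"

text \<open>Finiteness rules out the degenerate value of \<^const>\<open>card\<close> on infinite sets.\<close>

lemma finite_ulam_words: "finite (ulam_words n)"
  unfolding ulam_words_def
  using finite_lists_length_eq[of "UNIV :: bool set" n] by (rule rev_finite_subset) auto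

end

theory Submission
  imports Defs
begin

text \<open>Complementing letters preserves Ulam words, so it suffices to find n + 2 Ulam words of length n
  in which fewer than half of the letters are 1.  Few 1s suffice: writing a word as
  \<open>0\<^sup>a m 0\<^sup>c\<close> with \<open>m\<close> beginning and ending in 1, an Ulam splitting either removes one outer 0 or
  cuts \<open>m\<close>, which gives a recursion on \<open>a + c\<close>.  For even n it yields the four words
  with \<open>m = 1\<close> and \<open>a \<le> 1\<close> or \<open>c \<le> 1\<close>, and all n - 2 words with \<open>m = 101\<close>.  For odd n it yields the
  two words with \<open>m = 1\<close> and \<open>a = 0\<close> or \<open>c = 0\<close>, all n - 1 words with \<open>m = 11\<close>, and the word with
  \<open>m = 10101\<close> and \<open>c = 0\<close>.\<close>

section \<open>Ulam words via admissible cut positions\<close>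

definition ulam_split :: "bool list \<Rightarrow> nat \<Rightarrow> bool" where
  "ulam_split w i \<longleftrightarrow> ulam (take i w) \<and> ulam (drop i w) \<and> take i w \<noteq> drop i w"

text \<open>An ordered pair with concatenation \<open>w\<close> is determined by the length of its
  first word. Ulam words are nonempty, so this length lies strictly between 0 and
  \<open>length w\<close>.\<close>

lemma ulam_iff_ex1_split:
  assumes "length w \<noteq> 1"
  shows "ulam w \<longleftrightarrow> (\<exists>!i. i \<in> {1..<length w} \<and> ulam_split w i)"
proof -
  let ?P = "\<lambda>p. ulam (fst p) \<and> ulam (snd p) \<and> fst p \<noteq> snd p \<and> w = fst p @ snd p"
  have "w \<noteq> [False]" "w \<noteq> [True]"
    using assms by auto
  then have "ulam w \<longleftrightarrow> (\<exists>!p. ?P p)"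
    by (simp add: ulam_iff case_prod_unfold)
  also have "\<dots> \<longleftrightarrow> (\<exists>!i. i \<in> {1..<length w} \<and> ulam_split w i)"
  proof
    assume "\<exists>!p. ?P p"
    then obtain p where p: "?P p" and uniq: "\<And>q. ?P q \<Longrightarrow> q = p"
      by blast
    show "\<exists>!i. i \<in> {1..<length w} \<and> ulam_split w i"
    proof (intro ex1I conjI)
      have "fst p \<noteq> []" "snd p \<noteq> []"
        using p not_ulam_Nil by metis+
      then show "length (fst p) \<in> {1..<length w}" "ulam_split w (length (fst p))"
        using p by (auto simp: ulam_split_def Suc_le_eq)
    next
      fix i assume i: "i \<in> {1..<length w} \<and> ulam_split w i"
      then have "(take i w, drop i w) = p"
        by (intro uniq) (auto simp: ulam_split_def)
      then show "i = length (fst p)"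
        using i by auto
    qed
  next
    assume "\<exists>!i. i \<in> {1..<length w} \<and> ulam_split w i"
    then obtain i where i: "i \<in> {1..<length w}" "ulam_split w i"
      and uniq: "\<And>j. j \<in> {1..<length w} \<Longrightarrow> ulam_split w j \<Longrightarrow> j = i"
      by blast
    show "\<exists>!p. ?P p"
    proof (rule ex1I)
      show "?P (take i w, drop i w)"
        using i by (auto simp: ulam_split_def)
    next
      fix p assume p: "?P p"
      then have ne: "fst p \<noteq> []" "snd p \<noteq> []"
        using not_ulam_Nil by metis+
      have "length (fst p) = i"
        using p ne by (intro uniq) (auto simp: ulam_split_def Suc_le_eq)
      then show "p = (take i w, drop i w)"
        using p by (auto simp: prod_eq_iff)
    qed
  qed
  finally show ?thesis .
qed

text \<open>Counting by a sum of indicators lets the cut positions be treated block by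
  block.\<close>

lemma ulam_iff_sum_splits:
  assumes "length w \<noteq> 1"
  shows "ulam w \<longleftrightarrow> (\<Sum>i\<in>{1..<length w}. of_bool (ulam_split w i)) = (1::nat)"
proof -
  have "(\<Sum>i\<in>{1..<length w}. of_bool (ulam_split w i)) = card {i \<in> {1..<length w}. ulam_split w i}"
    by (simp add: of_bool_def sum.If_cases Int_def)
  moreover have "(\<exists>!i. i \<in> {1..<length w} \<and> ulam_split w i) \<longleftrightarrow>
      card {i \<in> {1..<length w}. ulam_split w i} = 1"
    unfolding One_nat_def card_1_singleton_iff set_eq_iff mem_Collect_eq singleton_iff by metis
  ultimately show ?thesis
    using ulam_iff_ex1_split[OF assms] by simp
qed

section \<open>Complements and constant words\<close>

lemma map_Not_eq_iff: "map Not v = map Not w \<longleftrightarrow> v = w"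
  by (rule inj_map_eq_map) (simp add: inj_def)

lemma ulam_map_Not: "ulam (map Not w) \<longleftrightarrow> ulam w"
proof (induction w rule: length_induct)
  case (1 w)
  show ?case
  proof (cases "length w = 1")
    case True
    then obtain b where "w = [b]"
      by (auto simp: length_Suc_conv)
    then show ?thesis
      by (simp add: ulam_letter)
  next
    case False
    have "ulam_split (map Not w) i \<longleftrightarrow> ulam_split w i" if "i \<in> {1..<length w}" for i
      using 1 that by (auto simp: ulam_split_def take_map drop_map map_Not_eq_iff)
    then have "(\<exists>!i. i \<in> {1..<length w} \<and> ulam_split (map Not w) i) \<longleftrightarrow>
        (\<exists>!i. i \<in> {1..<length w} \<and> ulam_split w i)"
      by (intro arg_cong[where f = Ex1] ext) blast
    then show ?thesis
      using False ulam_iff_ex1_split[of w] ulam_iff_ex1_split[of "map Not w"] by simp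
  qed
qed

text \<open>By induction, two Ulam pieces of a constant word are single letters, hence equal, so no
  cut is admissible.\<close>

lemma ulam_replicate: "ulam (replicate k b) \<longleftrightarrow> k = 1"
proof (induction k rule: less_induct)
  case (less k)
  show ?case
  proof (cases "k = 1")
    case True
    then show ?thesis
      by (simp add: ulam_letter)
  next
    case False
    have "\<not> ulam_split (replicate k b) i" if "i \<in> {1..<k}" for i
      using less that by (auto simp: ulam_split_def min_def)
    then show ?thesis
      using False ulam_iff_ex1_split[of "replicate k b"] by auto
  qed
qed

section \<open>Padding with zeros and the recursion on it\<close>

definition pad :: "nat \<Rightarrow> bool list \<Rightarrow> nat \<Rightarrow> bool list" where
  "pad a m c = replicate a False @ m @ replicate c False"

lemma length_pad [simp]: "length (pad a m c) = a + length m + c"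
  by (simp add: pad_def)

lemma count_list_pad [simp]: "count_list (pad a m c) True = count_list m True"
  by (simp add: pad_def)

text \<open>A split inside one of the two outer blocks of zeros is possible only if it cuts off a single
  letter, since longer constant words are not Ulam.\<close>

lemma ulam_pad_iff:
  assumes T: "True \<in> set m" and len: "a + length m + c \<noteq> 1"
  shows "ulam (pad a m c) \<longleftrightarrow>
    of_bool (0 < a \<and> ulam (pad (a - 1) m c)) + of_bool (0 < c \<and> ulam (pad a m (c - 1))) +
    (\<Sum>j\<in>{1..<length m}. of_bool (ulam (pad a (take j m) 0) \<and> ulam (pad 0 (drop j m) c) \<and>
       pad a (take j m) 0 \<noteq> pad 0 (drop j m) c)) = (1::nat)"
proof -
  let ?w = "pad a m c" and ?l = "length m"
  let ?f = "\<lambda>i. of_bool (ulam_split (pad a m c) i) :: nat"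
  have "m \<noteq> []"
    using T by auto
  then have l: "0 < ?l"
    by simp
  have left: "?f i = of_bool (i = 1 \<and> ulam (pad (a - 1) m c))" if "i \<in> {1..a}" for i
  proof -
    have tk: "take i ?w = replicate i False"
      and dr: "drop i ?w = pad (a - i) m c"
      using that by (simp_all add: pad_def)
    \<comment> \<open>Only one of the two pieces contains a 1, so they are automatically
      distinct.\<close>
    have "True \<in> set (pad (a - i) m c)" "True \<notin> set (replicate i False)"
      using T by (auto simp: pad_def)
    then have "replicate i False \<noteq> pad (a - i) m c"
      by metis
    then show ?thesis
      unfolding ulam_split_def tk dr by (auto simp: ulam_replicate)
  qed
  have right: "?f (a + ?l + i) = of_bool (i = c - 1 \<and> ulam (pad a m (c - 1)))" if "i < c" for i
  proof -
    have tk: "take (a + ?l + i) ?w = pad a m i"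
      and dr: "drop (a + ?l + i) ?w = replicate (c - i) False"
      using that by (simp_all add: pad_def)
    have "True \<in> set (pad a m i)" "True \<notin> set (replicate (c - i) False)"
      using T by (auto simp: pad_def)
    then have "pad a m i \<noteq> replicate (c - i) False"
      by metis
    moreover have "c - i = 1 \<longleftrightarrow> i = c - 1"
      using that by auto
    ultimately show ?thesis
      unfolding ulam_split_def tk dr by (auto simp: ulam_replicate)
  qed
  have mid: "?f (a + j) = of_bool (ulam (pad a (take j m) 0) \<and> ulam (pad 0 (drop j m) c) \<and>
       pad a (take j m) 0 \<noteq> pad 0 (drop j m) c)" if "j \<in> {1..<?l}" for j
    using that by (simp add: ulam_split_def pad_def)
  \<comment> \<open>Cuts at most \<open>a\<close> fall in the left block and cuts from
    \<open>a + ?l\<close> on in the right one; the rest are interior to \<open>m\<close>.\<close>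
  have dec: "{1..<a + ?l + c} = {1..a} \<union> (+) a ` {1..<?l} \<union> (+) (a + ?l) ` {..<c}"
  proof -
    have "(+) a ` {1..<?l} = {a + 1..<a + ?l}"
      by (simp add: add.commute)
    moreover have "(+) (a + ?l) ` {..<c} = {a + ?l..<a + ?l + c}"
      by (simp add: lessThan_atLeast0 add.commute add.left_commute)
    ultimately show ?thesis
      using l by (simp only: set_eq_iff Un_iff atLeastLessThan_iff atLeastAtMost_iff) linarith
  qed
  have "sum ?f {1..<a + ?l + c} =
      sum ?f {1..a} + sum ?f ((+) a ` {1..<?l}) + sum ?f ((+) (a + ?l) ` {..<c})"
    unfolding dec using \<open>m \<noteq> []\<close> by (subst sum.union_disjoint; (subst sum.union_disjoint)?) auto
  also have "\<dots> = (\<Sum>i\<in>{1..a}. of_bool (i = 1 \<and> ulam (pad (a - 1) m c))) +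
      (\<Sum>j\<in>{1..<?l}. of_bool (ulam (pad a (take j m) 0) \<and> ulam (pad 0 (drop j m) c) \<and>
         pad a (take j m) 0 \<noteq> pad 0 (drop j m) c)) +
      (\<Sum>i\<in>{..<c}. of_bool (i = c - 1 \<and> ulam (pad a m (c - 1))))"
    unfolding sum.reindex[OF inj_on_add] o_def
    using left mid right by (intro arg_cong2[where f = "(+)"] sum.cong) simp_all
  also have "(\<Sum>i\<in>{1..a}. of_bool (i = 1 \<and> ulam (pad (a - 1) m c))) =
      (of_bool (0 < a \<and> ulam (pad (a - 1) m c)) :: nat)"
    by (cases "ulam (pad (a - 1) m c)") (auto simp: of_bool_def)
  also have "(\<Sum>i\<in>{..<c}. of_bool (i = c - 1 \<and> ulam (pad a m (c - 1)))) =
      (of_bool (0 < c \<and> ulam (pad a m (c - 1))) :: nat)"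
    by (cases "ulam (pad a m (c - 1))") (auto simp: of_bool_def)
  finally show ?thesis
    using ulam_iff_sum_splits[of ?w] len by (simp add: algebra_simps)
qed

section \<open>Families of Ulam words with at most three 1s\<close>

text \<open>A single 1 has no inner cut, so only the removals of an outer zero remain. This is the
  recursion of Pascal's triangle modulo 2: the word is Ulam iff the binomial coefficient of
  \<open>a + c\<close> over \<open>a\<close> is odd.\<close>

lemma ulam_pad_1_iff:
  "ulam (pad a [True] c) \<longleftrightarrow> a + c = 0 \<or>
     (0 < a \<and> ulam (pad (a - 1) [True] c)) \<noteq> (0 < c \<and> ulam (pad a [True] (c - 1)))"
proof (cases "a + c = 0")
  case True
  then show ?thesis
    by (simp add: pad_def ulam_letter)
next
  case False
  then show ?thesis
    by (subst ulam_pad_iff) auto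
qed

lemma ulam_pad_1_0: "ulam (pad a [True] 0)"
  by (induction a; subst ulam_pad_1_iff) auto

lemma ulam_pad_0_1: "ulam (pad 0 [True] c)"
  by (induction c; subst ulam_pad_1_iff) auto

lemma ulam_pad_1_1: "ulam (pad a [True] (Suc 0)) \<longleftrightarrow> even a"
  by (induction a; subst ulam_pad_1_iff) (auto simp: ulam_pad_1_0)

lemma ulam_pad_1_1': "ulam (pad (Suc 0) [True] c) \<longleftrightarrow> even c"
  by (induction c; subst ulam_pad_1_iff) (auto simp: ulam_pad_0_1)

text \<open>For \<open>a + c > 0\<close> the cut between the two 1s is always admissible, so the
  word is Ulam iff removing an outer zero never leaves an Ulam word; hence the alternation in
  \<open>a + c\<close>.\<close>

lemma ulam_pad_11: "ulam (pad a [True, True] c) \<longleftrightarrow> odd (a + c)"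
proof (induction "a + c" arbitrary: a c rule: less_induct)
  case less
  have "(pad a [True] 0 \<noteq> pad 0 [True] c) \<longleftrightarrow> a + c \<noteq> 0"
    by (cases a; cases c) (auto simp: pad_def)
  then show ?case
    using less by (subst ulam_pad_iff) (auto simp: ulam_pad_1_0 ulam_pad_0_1 of_bool_def)
qed

text \<open>A core beginning with 1 ends the initial run of zeros, so the word determines
  \<open>a\<close> as the length of that run.\<close>

lemma pad_eq_imp_eq:
  assumes "pad a m c = pad a' m' c'" "m \<noteq> []" "hd m" "m' \<noteq> []" "hd m'"
  shows "a = a'"
proof -
  have "length (takeWhile Not (pad b (True # k) d)) = b" for b k d
    by (induction b) (auto simp: pad_def)
  then show ?thesis
    using assms by (metis (full_types) list.collapse)
qed

lemma ulam_pad_101: "ulam (pad a [True, False, True] c) \<longleftrightarrow> odd (a + c) \<and> a + c \<noteq> 1"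
proof (induction "a + c" arbitrary: a c rule: less_induct)
  case less
  \<comment> \<open>The middle zero of the core joins the padding of one piece, so both pieces have
    a single 1.\<close>
  have eqs: "pad 0 [False, True] c = pad (Suc 0) [True] c" "pad a [True, False] 0 = pad a [True] (Suc 0)"
    by (simp_all add: pad_def)
  have "pad a [True] 0 = pad (Suc 0) [True] c \<longleftrightarrow> a = 1 \<and> c = 0"
    using pad_eq_imp_eq[of a "[True]" 0 "Suc 0" "[True]" c] by (auto simp: pad_def)
  moreover have "pad a [True] (Suc 0) = pad 0 [True] c \<longleftrightarrow> a = 0 \<and> c = 1"
    using pad_eq_imp_eq[of a "[True]" "Suc 0" 0 "[True]" c]
    by (cases c) (auto simp: pad_def)
  moreover have "0 < a \<and> ulam (pad (a - Suc 0) [True, False, True] c) \<longleftrightarrow>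
      0 < a \<and> even (a + c) \<and> a + c \<noteq> 2"
    using less[of "a - 1" c] by (cases a) auto
  moreover have "0 < c \<and> ulam (pad a [True, False, True] (c - Suc 0)) \<longleftrightarrow>
      0 < c \<and> even (a + c) \<and> a + c \<noteq> 2"
    using less[of a "c - 1"] by (cases c) auto
  ultimately have "ulam (pad a [True, False, True] c) \<longleftrightarrow>
      of_bool (0 < a \<and> even (a + c) \<and> a + c \<noteq> 2) + of_bool (0 < c \<and> even (a + c) \<and> a + c \<noteq> 2) +
      (of_bool (even c \<and> \<not> (a = 1 \<and> c = 0)) + of_bool (even a \<and> \<not> (a = 0 \<and> c = 1))) = (1::nat)"
    by (subst ulam_pad_iff)
      (simp_all add: eqs ulam_pad_1_0 ulam_pad_0_1 ulam_pad_1_1 ulam_pad_1_1')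
  then show ?case
    \<comment> \<open>If \<open>a + c\<close> is odd, no outer removal counts, and exactly one inner
      cut does unless \<open>a + c = 1\<close>, where its pieces coincide. If both are even, both
      inner cuts count; if both are odd, the two outer removals count together or not at
      all.\<close>
    by (cases "even a"; cases "even c"; cases "a = 0"; cases "c = 0") (auto simp: of_bool_def)
qed

text \<open>The first two inner cuts never count, since \<open>01010\<close> shortened to
  \<open>0101\<close> and the word \<open>101\<close> are not Ulam. The third counts for odd
  \<open>a > 1\<close>, the fourth for even \<open>a > 0\<close>, and removing the first zero adds a
  second splitting for odd \<open>a > 1\<close>.\<close>

lemma ulam_pad_10101: "ulam (pad a [True, False, True, False, True] 0) \<longleftrightarrow> even a \<and> a \<noteq> 0"
proof (induction a)
  have eqs: "pad 0 [False, True, False, True] 0 = pad (Suc 0) [True, False, True] 0"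
    "pad 0 [False, True] 0 = pad (Suc 0) [True] 0"
    "pad a [True, False, True, False] 0 = pad a [True, False, True] (Suc 0)" for a
    by (simp_all add: pad_def)
  have neq: "pad a [True, False, True] 0 \<noteq> pad (Suc 0) [True] 0"
    "pad a [True, False, True] (Suc 0) \<noteq> pad 0 [True] 0" for a
    by (auto dest: arg_cong[where f = "\<lambda>w. count_list w True"])
  {
    case 0
    show ?case
      by (subst ulam_pad_iff) (simp_all add: eqs ulam_pad_101)
  next
    case (Suc a)
    then show ?case
      by (subst ulam_pad_iff)
        (auto simp: eqs neq ulam_pad_101 ulam_pad_1_0 of_bool_def)
  }
qed

section \<open>Counting words of a fixed length\<close>

lemma card_ulam_words_ge:
  assumes "\<And>w. w \<in> A \<Longrightarrow> ulam w \<and> length w = n \<and> 2 * count_list w True < n"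
  shows "2 * card A \<le> card (ulam_words n)"
proof -
  have sub: "A \<union> map Not ` A \<subseteq> ulam_words n"
    using assms by (auto simp: ulam_words_def ulam_map_Not)
  then have fin: "finite A"
    using finite_ulam_words finite_subset by blast
  have count: "count_list (map Not w) True + count_list w True = length w" for w
    by (induction w) auto
  \<comment> \<open>The numbers of 1s in a word and its complement add up to \<open>n\<close>, so
    they cannot both be below half of \<open>n\<close>.\<close>
  have "A \<inter> map Not ` A = {}"
  proof (safe)
    fix w assume "w \<in> A" "map Not w \<in> A"
    then show "map Not w \<in> {}"
      using assms[of w] assms[of "map Not w"] count[of w] by simp
  qed
  then have "card (A \<union> map Not ` A) = card A + card (map Not ` A)"
    using fin by (simp add: card_Un_disjoint)
  also have "card (map Not ` A) = card A"
    by (rule card_image) (simp add: inj_on_def map_Not_eq_iff)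
  finally show ?thesis
    using card_mono[OF finite_ulam_words sub] by simp
qed

text \<open>The trailing zeros fill the word up to length \<open>n\<close>; as subtraction
  truncates, this needs \<open>a + length m \<le> n\<close>.\<close>

definition pads :: "nat \<Rightarrow> bool list \<Rightarrow> nat set \<Rightarrow> bool list set" where
  "pads n m B = (\<lambda>a. pad a m (n - length m - a)) ` B"

lemma card_pads:
  assumes "m \<noteq> []" "hd m"
  shows "card (pads n m B) = card B"
  unfolding pads_def using assms pad_eq_imp_eq by (intro card_image inj_onI) blast

lemma finite_pads [simp]: "finite B \<Longrightarrow> finite (pads n m B)"
  by (simp add: pads_def)

lemma count_list_pads: "w \<in> pads n m B \<Longrightarrow> count_list w True = count_list m True"
  by (auto simp: pads_def)

lemma disjoint_pads:
  assumes "count_list m True \<noteq> count_list m' True"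
  shows "pads n m B \<inter> pads n m' B' = {}"
  using assms count_list_pads[of _ n m B] count_list_pads[of _ n m' B'] by (metis disjoint_iff)

theorem theorem1p1:
  fixes n :: nat
  assumes "n \<ge> 6"
  shows "card (ulam_words n) \<ge> 2 * n + 4"
proof -
  have "\<exists>A. card A = n + 2 \<and> (\<forall>w\<in>A. ulam w \<and> length w = n \<and> 2 * count_list w True < n)"
  proof (cases "even n")
    case True
    let ?A = "pads n [True] {0, 1, n - 2, n - 1}" and ?B = "pads n [True, False, True] {..n - 3}"
    \<comment> \<open>Evenness of \<open>n\<close> is what makes these two words Ulam. For the core
      \<open>101\<close> the padding totals \<open>n - 3\<close>, which is odd and at least
      3.\<close>
    have "ulam (pad (n - 2) [True] (Suc 0))" "ulam (pad (Suc 0) [True] (n - 2))"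
      using True assms by (simp_all add: ulam_pad_1_1 ulam_pad_1_1')
    then have A: "ulam w \<and> length w = n \<and> count_list w True = 1" if "w \<in> ?A" for w
      using that assms
      by (auto simp: pads_def ulam_pad_1_0 ulam_pad_0_1 Suc_diff_Suc numeral_2_eq_2)
    have B: "ulam w \<and> length w = n \<and> count_list w True = 2" if "w \<in> ?B" for w
      using that True assms by (auto simp: pads_def ulam_pad_101)
    have "card (?A \<union> ?B) = card ?A + card ?B"
      by (intro card_Un_disjoint disjoint_pads) auto
    moreover have "card {0, 1, n - 2, n - 1} = 4"
      using assms by (auto simp: card_insert_if)
    ultimately have "card (?A \<union> ?B) = n + 2"
      using assms by (simp add: card_pads)
    then show ?thesis
      using A B assms by (intro exI[of _ "?A \<union> ?B"]) auto
  next
    case False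
    let ?A = "pads n [True] {0, n - 1}" and ?B = "pads n [True, True] {..n - 2}"
      and ?C = "pads n [True, False, True, False, True] {n - 5}"
    have A: "ulam w \<and> length w = n \<and> count_list w True = 1" if "w \<in> ?A" for w
      using that assms by (auto simp: pads_def ulam_pad_1_0 ulam_pad_0_1)
    have B: "ulam w \<and> length w = n \<and> count_list w True = 2" if "w \<in> ?B" for w
      using that False assms by (auto simp: pads_def ulam_pad_11)
    have C: "ulam w \<and> length w = n \<and> count_list w True = 3" if "w \<in> ?C" for w
      using that False assms by (auto simp: pads_def ulam_pad_10101)
    \<comment> \<open>The words in \<open>?C\<close> have three 1s, which is fewer than half of the
      letters only for \<open>n > 6\<close>.\<close>
    have "n \<ge> 7"
      using False assms by (cases "n = 6") auto
    have "card (?A \<union> (?B \<union> ?C)) = card ?A + (card ?B + card ?C)"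
      by (subst card_Un_disjoint; (subst card_Un_disjoint)?)
         (auto simp: Int_Un_distrib intro!: disjoint_pads)
    \<comment> \<open>The three families contribute \<open>2\<close>, \<open>n - 1\<close> and
      \<open>1\<close>.\<close>
    also have "\<dots> = n + 2"
      using assms by (simp add: card_pads)
    finally show ?thesis
      using A B C \<open>n \<ge> 7\<close> by (intro exI[of _ "?A \<union> (?B \<union> ?C)"]) auto
  qed
  then obtain A where "card A = n + 2"
    "\<And>w. w \<in> A \<Longrightarrow> ulam w \<and> length w = n \<and> 2 * count_list w True < n"
    by blast
  then show ?thesis
    using card_ulam_words_ge[of A n] by simp
qed

end
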